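(* Let $\mathscr H$ be a separable Hilbert space, $\Gamma:\mathrm{dom}(\Gamma)\subset\mathscr H\to\mathscr H$ a closed, densely-defined, nilpotent operator, and $B:\mathscr H\to\mathscr H$ a bounded, positive-definite, self-adjoint isomorphism. Let $\Pi:=\Gamma+\Gamma^*$ and $\Pi_B:=\Gamma+\Gamma^{*,B}$, and set $\mathcal X:=\ker(\Pi_B)+\overline{\mathrm{ran}(\Pi)}$. Then $$\mathcal X=\ker(\Pi_B)\oplus\overline{\mathrm{ran}(\Pi)}=\mathscr H.$$
   Context: Nilpotent means $\mathrm{ran}(\Gamma)\subset\ker(\Gamma)$. $\Gamma^*$ is the adjoint of $\Gamma$ with respect to $\langle\cdot,\cdot\rangle$; $\Gamma^{*,B}$ is the adjoint of $\Gamma$ with respect to the inner product $\langle u,v\rangle_B:=\langle Bu,v\rangle$. The sums have domains $\mathrm{dom}(\Pi)=\mathrm{dom}(\Gamma)\cap\mathrm{dom}(\Gamma^* )$ and $\mathrm{dom}(\Pi_B)=\mathrm{dom}(\Gamma)\cap\mathrm{dom}(\Gamma^{*,B})$. The direct sum is topological, not necessarily orthogonal. *)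

theory Defs
  imports "HOL-Analysis.Analysis"
begin

text \<open>
  Scalar fields with a conjugation. By the last axiom the conjugation is determined by the norm,
  and by Gelfand--Mazur the only instances up to isomorphism are the real and the complex numbers,
  so that statements over this class cover real and complex Hilbert spaces alike.
\<close>

class conj_field = real_normed_field +
  fixes conjg :: "'a \<Rightarrow> 'a"
  assumes conj_add: "conjg (x + y) = conjg x + conjg y"
    and conj_mult: "conjg (x * y) = conjg x * conjg y"
    and conj_conj: "conjg (conjg x) = x"
    and mult_conj: "x * conjg x = (norm x)\<^sup>2 *\<^sub>R 1"

instantiation real :: conj_field
begin

definition conjg_real :: "real \<Rightarrow> real"
  where "conjg_real x = x"

instance
  by standard (auto simp: conjg_real_def power2_eq_square)

end

instantiation complex :: conj_field
begin

definition conjg_complex :: "complex \<Rightarrow> complex"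
  where "conjg_complex = cnj"

instance
  by standard (auto simp: conjg_complex_def scaleR_conv_of_real complex_norm_square[symmetric] simp del: of_real_power)

end

text \<open>
  The norm, the topology and the completeness of the space are those of the sort \<open>banach\<close>; the
  axioms tie them to the scalar multiplication over \<open>'k\<close> and to the inner product, which is
  linear in its first argument.
\<close>

locale hilbert_space = vector_space smul
  for smul :: "'k::conj_field \<Rightarrow> 'h::banach \<Rightarrow> 'h" +
  fixes ip :: "'h \<Rightarrow> 'h \<Rightarrow> 'k"
  assumes scale_of_real: "smul (of_real r) u = r *\<^sub>R u"
    and ip_add_left: "ip (u + v) w = ip u w + ip v w"
    and ip_scale_left: "ip (smul c u) w = c * ip u w"
    and ip_conj: "ip v u = conjg (ip u v)"
    and ip_self: "ip u u = of_real ((norm u)\<^sup>2)"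

text \<open>
  A possibly unbounded operator is a partial function, so that its domain and its range are
  \<^const>\<open>dom\<close> and \<^const>\<open>ran\<close>, and its graph is \<^const>\<open>Map.graph\<close>.
\<close>

definition linear_operator ::
    "('k::field \<Rightarrow> 'h::ab_group_add \<Rightarrow> 'h) \<Rightarrow> ('h \<rightharpoonup> 'h) \<Rightarrow> bool"
  where "linear_operator smul T \<longleftrightarrow>
    module.subspace smul (dom T) \<and>
    (\<forall>u\<in>dom T. \<forall>v\<in>dom T. the (T (u + v)) = the (T u) + the (T v)) \<and>
    (\<forall>c. \<forall>u\<in>dom T. the (T (smul c u)) = smul c (the (T u)))"

definition closed_operator :: "('h::topological_space \<rightharpoonup> 'h) \<Rightarrow> bool"
  where "closed_operator T \<longleftrightarrow> closed (Map.graph T)"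

definition densely_defined :: "('h::topological_space \<rightharpoonup> 'h) \<Rightarrow> bool"
  where "densely_defined T \<longleftrightarrow> closure (dom T) = UNIV"

definition ker :: "('h::zero \<rightharpoonup> 'h) \<Rightarrow> 'h set"
  where "ker T = {u. T u = Some 0}"

definition nilpotent :: "('h::zero \<rightharpoonup> 'h) \<Rightarrow> bool"
  where "nilpotent T \<longleftrightarrow> ran T \<subseteq> ker T"

definition op_sum :: "('h::plus \<rightharpoonup> 'h) \<Rightarrow> ('h \<rightharpoonup> 'h) \<Rightarrow> ('h \<rightharpoonup> 'h)"
  where "op_sum S T =
    (\<lambda>u. if u \<in> dom S \<inter> dom T then Some (the (S u) + the (T u)) else None)"

text \<open>
  The adjoint is taken with respect to an arbitrary pairing, so that the same definition applies to
  the given inner product and to a changed one. The vector \<open>w\<close> below is unique when \<open>T\<close> is densely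
  defined; the definition is only meaningful in that case.
\<close>

definition op_adjoint :: "('h \<Rightarrow> 'h \<Rightarrow> 'k) \<Rightarrow> ('h \<rightharpoonup> 'h) \<Rightarrow> ('h \<rightharpoonup> 'h)"
  where "op_adjoint ip T =
    (\<lambda>v. if \<exists>w. \<forall>u\<in>dom T. ip (the (T u)) v = ip u w
          then Some (THE w. \<forall>u\<in>dom T. ip (the (T u)) v = ip u w)
          else None)"

definition weighted_ip :: "('h \<Rightarrow> 'h) \<Rightarrow> ('h \<Rightarrow> 'h \<Rightarrow> 'k) \<Rightarrow> 'h \<Rightarrow> 'h \<Rightarrow> 'k"
  where "weighted_ip B ip u v = ip (B u) v"

definition bounded_operator ::
    "('k::field \<Rightarrow> 'h::real_normed_vector \<Rightarrow> 'h) \<Rightarrow> ('h \<Rightarrow> 'h) \<Rightarrow> bool"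
  where "bounded_operator smul B \<longleftrightarrow>
    Vector_Spaces.linear smul smul B \<and> (\<exists>K. \<forall>u. norm (B u) \<le> K * norm u)"

definition isomorphism ::
    "('k::field \<Rightarrow> 'h::real_normed_vector \<Rightarrow> 'h) \<Rightarrow> ('h \<Rightarrow> 'h) \<Rightarrow> bool"
  where "isomorphism smul B \<longleftrightarrow>
    bij B \<and> bounded_operator smul B \<and> bounded_operator smul (inv B)"

definition self_adjoint :: "('h \<Rightarrow> 'h \<Rightarrow> 'k) \<Rightarrow> ('h \<Rightarrow> 'h) \<Rightarrow> bool"
  where "self_adjoint ip B \<longleftrightarrow> (\<forall>u v. ip (B u) v = ip u (B v))"

definition positive_definite ::
    "('h::zero \<Rightarrow> 'h \<Rightarrow> 'k::real_algebra_1) \<Rightarrow> ('h \<Rightarrow> 'h) \<Rightarrow> bool"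
  where "positive_definite ip B \<longleftrightarrow> (\<forall>u. u \<noteq> 0 \<longrightarrow> (\<exists>r>0. ip (B u) u = of_real r))"

text \<open>
  A direct sum is topological if addition is a homeomorphism from the product of the summands, that
  is, if the projections onto the summands are continuous.
\<close>

definition topological_direct_sum ::
    "('k::field \<Rightarrow> 'h::real_normed_vector \<Rightarrow> 'h) \<Rightarrow> 'h set \<Rightarrow> 'h set \<Rightarrow> 'h set \<Rightarrow> bool"
  where "topological_direct_sum smul W U V \<longleftrightarrow>
    module.subspace smul U \<and> module.subspace smul V \<and>
    U \<inter> V = {0} \<and> W = U + V \<and>
    (\<exists>g. homeomorphism (U \<times> V) W (\<lambda>(u, v). u + v) g)"

end

theory Submission
  imports Defs
begin

text \<open>
  Write \<open>N = ker \<Gamma>\<close> and \<open>R = closure (ran \<Gamma>)\<close>, so that \<open>R \<subseteq> N\<close> by nilpotency. Then \<open>ker \<Pi>\<^sub>B\<close> is the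
  orthogonal complement of \<open>R\<close> in \<open>N\<close> with respect to the weighted inner product, while the
  closure of \<open>ran \<Pi>\<close> is the sum of \<open>R\<close> and the unweighted orthogonal complement of \<open>N\<close>.
  Projecting first onto \<open>N\<close> and then, in the weighted inner product, onto \<open>R\<close> decomposes every
  vector. The projection along the second summand is bounded because both projections are and
  the two norms are equivalent.

  Only the real parts of the inner products matter: they define the same adjoints and the same
  orthogonal complements of subspaces over the scalar field.
\<close>

subsection \<open>Coercive symmetric forms\<close>

text \<open>Symmetry and coercivity make \<open>b\<close> a real inner product whose norm is
  equivalent to the given one, so completeness carries over and orthogonal projections exist. The
  original and the weighted inner product both give instances.\<close>

locale coercive_form = bounded_bilinear b
  for b :: "'h::banach \<Rightarrow> 'h \<Rightarrow> real" +
  assumes sym: "b u v = b v u"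
    and coercive: "\<exists>c>0. \<forall>u. c * (norm u)\<^sup>2 \<le> b u u"
begin

lemma form_nonneg: "0 \<le> b u u"
proof -
  obtain c where "c > 0" "c * (norm u)\<^sup>2 \<le> b u u"
    using coercive by blast
  then show ?thesis
    by (smt (verit) mult_nonneg_nonneg zero_le_power2)
qed

lemma form_eq_0_iff: "b u u = 0 \<longleftrightarrow> u = 0"
proof
  assume "b u u = 0"
  moreover obtain c where c: "c > 0" "c * (norm u)\<^sup>2 \<le> b u u"
    using coercive by blast
  ultimately have "(norm u)\<^sup>2 \<le> 0"
    by (metis mult_le_0_iff not_le)
  then show "u = 0"
    by simp
qed (simp add: zero_left)

lemma form_add: "b (u + v) (u + v) = b u u + 2 * b u v + b v v"
  by (simp add: add_left add_right sym[of v u])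

lemma form_diff: "b (u - v) (u - v) = b u u - 2 * b u v + b v v"
  by (simp add: diff_left diff_right sym[of v u])

lemma continuous_on_form [continuous_intros]:
  "continuous_on A f \<Longrightarrow> continuous_on A g \<Longrightarrow> continuous_on A (\<lambda>x. b (f x) (g x))"
  by (rule continuous_on)

text \<open>A minimizing sequence for the \<open>b\<close>-distance from \<open>x\<close> to
  \<open>S\<close> is Cauchy by the parallelogram law and coercivity. Moving its limit along a
  vector of \<open>S\<close> cannot decrease the distance, which forces orthogonality.\<close>

lemma orthogonal_projection_exists:
  assumes S: "subspace S" and cl: "closed S"
  obtains p where "p \<in> S" "\<And>s. s \<in> S \<Longrightarrow> b s (x - p) = 0"
proof -
  define q where "q u = b u u" for u
  define d where "d = (INF s\<in>S. q (x - s))"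
  have ne: "S \<noteq> {}"
    using S subspace_0 by blast
  have bdd: "bdd_below ((\<lambda>s. q (x - s)) ` S)"
    by (rule bdd_belowI2[of _ 0]) (simp add: q_def form_nonneg)
  have d_le: "d \<le> q (x - s)" if "s \<in> S" for s
    unfolding d_def using bdd that by (rule cINF_lower)
  have "\<exists>s\<in>S. q (x - s) < d + 1 / real (Suc n)" for n
  proof -
    have "d < d + 1 / real (Suc n)"
      by simp
    then show ?thesis
      unfolding d_def using cINF_less_iff[OF ne bdd] by blast
  qed
  then obtain s where s: "\<And>n. s n \<in> S" "\<And>n. q (x - s n) < d + 1 / real (Suc n)"
    by metis
  obtain c where c: "c > 0" "\<And>u. c * (norm u)\<^sup>2 \<le> q u"
    using coercive unfolding q_def by blast
  have est: "c * (norm (s m - s n))\<^sup>2 \<le> 2 / real (Suc m) + 2 / real (Suc n)" for m n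
  proof -
    \<comment> \<open>The midpoint stays in \<open>S\<close>, so \<open>q (x - ?h)\<close> is at
      least \<open>d\<close>; the parallelogram law then bounds
      \<open>q (s m - s n)\<close>.\<close>
    let ?h = "(1/2) *\<^sub>R (s m + s n)"
    have "?h \<in> S"
      using S s(1) by (intro subspace_scale subspace_add)
    then have "d \<le> q (x - ?h)"
      by (rule d_le)
    moreover have "q (s m - s n) + 4 * q (x - ?h) = 2 * q (x - s m) + 2 * q (x - s n)"
      unfolding q_def
      by (simp add: add_left add_right diff_left diff_right scaleR_left scaleR_right
          sym[of "s n" "s m"] sym[of x "s n"] sym[of x "s m"] algebra_simps)
    ultimately show ?thesis
      using c(2)[of "s m - s n"] s(2)[of m] s(2)[of n] by simp
  qed
  have "Cauchy s"
  proof (rule metric_CauchyI)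
    fix e :: real assume "e > 0"
    then have pos: "c * e\<^sup>2 / 4 > 0"
      using c(1) by simp
    obtain N where N: "1 / real (Suc N) < c * e\<^sup>2 / 4"
      using reals_Archimedean[OF pos] by (auto simp: inverse_eq_divide)
    have "dist (s m) (s n) < e" if "m \<ge> N" "n \<ge> N" for m n
    proof -
      have "1 / real (Suc m) \<le> 1 / real (Suc N)" "1 / real (Suc n) \<le> 1 / real (Suc N)"
        using that by (auto intro!: divide_left_mono)
      then have "c * (norm (s m - s n))\<^sup>2 < c * e\<^sup>2"
        using est[of m n] N by simp
      then have "(norm (s m - s n))\<^sup>2 < e\<^sup>2"
        using c(1) by simp
      then show ?thesis
        using \<open>e > 0\<close> by (simp add: dist_norm power_less_imp_less_base)
    qed
    then show "\<exists>N. \<forall>m\<ge>N. \<forall>n\<ge>N. dist (s m) (s n) < e"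
      by blast
  qed
  then obtain p where p: "s \<longlonglongrightarrow> p"
    using Cauchy_convergent convergent_def by blast
  have "p \<in> S"
    using cl s(1) p by (rule closed_sequentially)
  have "(\<lambda>n. q (x - s n)) \<longlonglongrightarrow> q (x - p)"
    unfolding q_def by (intro tendsto tendsto_diff tendsto_const p)
  moreover have "(\<lambda>n. d + 1 / real (Suc n)) \<longlonglongrightarrow> d + 0"
    using LIMSEQ_inverse_real_of_nat by (intro tendsto_add tendsto_const) (simp add: inverse_eq_divide)
  ultimately have qp: "q (x - p) \<le> d"
    using LIMSEQ_le[of "\<lambda>n. q (x - s n)" _ "\<lambda>n. d + 1 / real (Suc n)"] s(2)
    by (metis add_0_right less_imp_le)
  have "b t (x - p) = 0" if "t \<in> S" for t
  proof (cases "t = 0")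
    case False
    then have pos: "b t t > 0"
      using form_nonneg[of t] form_eq_0_iff[of t] by linarith
    \<comment> \<open>This is the minimizer of the quadratic polynomial
      \<open>q (x - p - k *\<^sub>R t)\<close> in \<open>k\<close>.\<close>
    define k where "k = b t (x - p) / b t t"
    have "p + k *\<^sub>R t \<in> S"
      using S \<open>p \<in> S\<close> that by (simp add: subspace_add subspace_scale)
    then have "q (x - p) \<le> q (x - p - k *\<^sub>R t)"
      using d_le qp by (metis diff_diff_eq order_trans)
    also have "\<dots> = q (x - p) - 2 * k * b t (x - p) + k\<^sup>2 * b t t"
      unfolding q_def form_diff
      by (simp add: scaleR_left scaleR_right sym[of "x - p" t] power2_eq_square)
    also have "\<dots> = q (x - p) - (b t (x - p))\<^sup>2 / b t t"
      using pos unfolding k_def by (simp add: field_simps power2_eq_square)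
    finally have "(b t (x - p))\<^sup>2 / b t t \<le> 0"
      by simp
    then have "(b t (x - p))\<^sup>2 \<le> 0"
      using pos by (simp add: divide_le_0_iff)
    then show ?thesis
      by simp
  qed (simp add: zero_left)
  then show thesis
    using that \<open>p \<in> S\<close> by blast
qed

text \<open>The bipolar property: if \<open>p\<close> is the projection of \<open>x\<close>, then
  \<open>x - p\<close> is orthogonal to \<open>S\<close>, hence by hypothesis to \<open>x\<close>,
  hence to itself.\<close>

lemma mem_if_orthogonal_complement:
  assumes "subspace S" "closed S"
    and x: "\<And>y. (\<And>s. s \<in> S \<Longrightarrow> b s y = 0) \<Longrightarrow> b x y = 0"
  shows "x \<in> S"
proof -
  obtain p where p: "p \<in> S" "\<And>s. s \<in> S \<Longrightarrow> b s (x - p) = 0"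
    using orthogonal_projection_exists[OF assms(1,2), of x] by blast
  then have "b (x - p) (x - p) = 0"
    using x[of "x - p"] by (simp add: diff_left)
  then show ?thesis
    using p(1) by (simp add: form_eq_0_iff)
qed

text \<open>Continuity extends the agreement to every \<open>u\<close>, in particular to
  \<open>v - w\<close>. This gives uniqueness of adjoints.\<close>

lemma eq_if_form_eq_on_dense:
  assumes "closure D = UNIV" "\<And>u. u \<in> D \<Longrightarrow> b u v = b u w"
  shows "v = w"
proof -
  have "closed {u. b u v = b u w}"
    by (intro closed_Collect_eq continuous_on_form continuous_intros)
  then have "closure D \<subseteq> {u. b u v = b u w}"
    using assms(2) by (intro closure_minimal) auto
  then have "b (v - w) (v - w) = 0"
    using assms(1) by (auto simp: diff_right)
  then show ?thesis
    by (simp add: form_eq_0_iff)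
qed

end

text \<open>Allows the bipolar property to be applied to the graph of a closed operator. Squared
  norms add in the product, so the coercivity constant is kept.\<close>

lemma coercive_form_prod:
  assumes "coercive_form a"
  shows "coercive_form (\<lambda>x y. a (fst x) (fst y) + a (snd x) (snd y))"
proof -
  interpret a: coercive_form a by fact
  obtain c where c: "c > 0" "\<And>u. c * (norm u)\<^sup>2 \<le> a u u"
    using a.coercive by blast
  obtain K where K: "K > 0" "\<And>u v. norm (a u v) \<le> norm u * norm v * K"
    using a.pos_bounded by blast
  show ?thesis
  proof
    show "\<exists>K. \<forall>x y. norm (a (fst x) (fst y) + a (snd x) (snd y)) \<le> norm x * norm y * K"
    proof (intro exI allI)
      fix x y :: "'a \<times> 'a"
      have le: "norm (fst z) \<le> norm z" "norm (snd z) \<le> norm z" for z :: "'a \<times> 'a"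
        by (metis norm_fst_le norm_snd_le prod.collapse)+
      have "norm (a (fst x) (fst y)) \<le> norm x * norm y * K"
        using K(1) by (intro order_trans[OF K(2)] mult_mono le) auto
      moreover have "norm (a (snd x) (snd y)) \<le> norm x * norm y * K"
        using K(1) by (intro order_trans[OF K(2)] mult_mono le) auto
      ultimately show "norm (a (fst x) (fst y) + a (snd x) (snd y)) \<le> norm x * norm y * (2 * K)"
        using norm_triangle_ineq[of "a (fst x) (fst y)" "a (snd x) (snd y)"] by simp
    qed
    have "c * (norm x)\<^sup>2 \<le> a (fst x) (fst x) + a (snd x) (snd x)" for x
      using c(2)[of "fst x"] c(2)[of "snd x"] by (simp add: norm_prod_def distrib_left)
    then show "\<exists>c>0. \<forall>x. c * (norm x)\<^sup>2 \<le> a (fst x) (fst x) + a (snd x) (snd x)"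
      using c(1) by blast
    show "a (fst x) (fst y) + a (snd x) (snd y) = a (fst y) (fst x) + a (snd y) (snd x)" for x y
      by (metis a.sym)
  qed (auto simp: a.add_left a.add_right a.scaleR_left a.scaleR_right algebra_simps)
qed

lemma op_sum_eq_Some_iff:
  "op_sum S T u = Some z \<longleftrightarrow> (\<exists>x y. S u = Some x \<and> T u = Some y \<and> z = x + y)"
  by (auto simp: op_sum_def)

text \<open>General in the scalars: the summands must be subspaces over \<open>'k\<close>, while the
  projections onto closures are taken for real subspaces.\<close>

lemma subspace_closure:
  fixes scale :: "'k::comm_ring_1 \<Rightarrow> 'a::real_normed_vector \<Rightarrow> 'a"
  assumes "module scale" and cont: "\<And>c. continuous_on UNIV (scale c)"
    and S: "module.subspace scale S"
  shows "module.subspace scale (closure S)"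
proof -
  interpret module scale by fact
  show ?thesis
  proof (rule subspaceI)
    show "0 \<in> closure S"
      using S subspace_0 closure_subset by blast
    have "(\<lambda>(x, y). x + y) ` closure (S \<times> S) \<subseteq> closure S"
      using subspace_add[OF S] closure_subset[of S]
      by (intro image_closure_subset) (auto simp: case_prod_unfold intro!: continuous_intros)
    then show "x + y \<in> closure S" if "x \<in> closure S" "y \<in> closure S" for x y
      using that by (auto simp: closure_Times image_subset_iff)
    have "scale c ` closure S \<subseteq> closure S" for c
      using subspace_scale[OF S] closure_subset[of S]
      by (intro image_closure_subset continuous_on_subset[OF cont]) auto
    then show "scale c x \<in> closure S" if "x \<in> closure S" for c x
      using that by blast
  qed
qed

lemma subspace_closure_real:
  fixes S :: "'a::real_normed_vector set"
  assumes "subspace S"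
  shows "subspace (closure S)"
  using assms unfolding subspace_raw_def
  by (intro subspace_closure) (auto intro: real_vector.module_axioms continuous_intros)

subsection \<open>Nilpotent operators and their adjoints under two forms\<close>

text \<open>
  The two adjoints enter only through the real parts of the two inner products, and of the
  weight only the equivalence of its form with the original one is needed.
\<close>

locale nilpotent_pair = a: coercive_form a + b: coercive_form b
  for a b :: "'h::banach \<Rightarrow> 'h \<Rightarrow> real" +
  fixes T A A' :: "'h \<rightharpoonup> 'h"
  assumes subspace_graph: "subspace (Map.graph T)"
    and closed_graph: "closed (Map.graph T)"
    and nilpotent: "T u = Some v \<Longrightarrow> T v = Some 0"
    and A_iff: "A v = Some w \<longleftrightarrow> (\<forall>u x. T u = Some x \<longrightarrow> a x v = a u w)"
    and A'_iff: "A' v = Some w \<longleftrightarrow> (\<forall>u x. T u = Some x \<longrightarrow> b x v = b u w)"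
begin

lemma T_0: "T 0 = Some 0"
  using subspace_0[OF subspace_graph] by (simp add: Map.graph_def zero_prod_def)

lemma T_add: "T u = Some x \<Longrightarrow> T v = Some y \<Longrightarrow> T (u + v) = Some (x + y)"
  using subspace_add[OF subspace_graph, of "(u, x)" "(v, y)"] by (simp add: Map.graph_def)

lemma T_diff: "T u = Some x \<Longrightarrow> T v = Some y \<Longrightarrow> T (u - v) = Some (x - y)"
  using subspace_diff[OF subspace_graph, of "(u, x)" "(v, y)"] by (simp add: Map.graph_def)

lemma T_scaleR: "T u = Some x \<Longrightarrow> T (r *\<^sub>R u) = Some (r *\<^sub>R x)"
  using subspace_scale[OF subspace_graph, of "(u, x)" r] by (simp add: Map.graph_def)

section \<open>Kernels and ranges of the operator and its adjoints\<close>

lemma subspace_ker: "subspace (ker T)"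
  unfolding ker_def using T_0 T_add T_scaleR by (force intro!: subspaceI)

lemma closed_ker: "closed (ker T)"
proof -
  have "ker T = (\<lambda>u. (u, 0)) -` Map.graph T"
    by (auto simp: ker_def Map.graph_def)
  then show ?thesis
    using closed_graph by (auto intro!: closed_vimage continuous_intros)
qed

lemma subspace_ran: "subspace (ran T)"
  unfolding ran_def using T_0 T_add T_scaleR by (fastforce intro!: subspaceI)

lemma closure_ran_subset_ker: "closure (ran T) \<subseteq> ker T"
  using closed_ker nilpotent by (intro closure_minimal) (auto simp: ran_def ker_def)

lemma A_orthogonal_ker: "A z = Some w \<Longrightarrow> T n = Some 0 \<Longrightarrow> a n w = 0"
  using A_iff[of z w] by (metis a.zero_left)

text \<open>Orthogonality to the range passes to its closure by continuity; the closure is what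
  vectors get projected onto.\<close>

lemma A_eq_0_iff: "A v = Some 0 \<longleftrightarrow> (\<forall>r\<in>closure (ran T). a r v = 0)"
proof -
  have "closed {r. a r v = 0}"
    by (intro closed_Collect_eq a.continuous_on_form continuous_intros)
  then have "closure (ran T) \<subseteq> {r. a r v = 0} \<longleftrightarrow> ran T \<subseteq> {r. a r v = 0}"
    using closure_minimal closure_subset by blast
  then show ?thesis
    by (auto simp: A_iff ran_def a.zero_right)
qed

lemma A'_eq_0_iff: "A' v = Some 0 \<longleftrightarrow> (\<forall>u x. T u = Some x \<longrightarrow> b x v = 0)"
  by (simp add: A'_iff b.zero_right)

text \<open>If \<open>x + y = 0\<close> with \<open>x\<close> in the range of \<open>T\<close> and
  \<open>y\<close> in that of \<open>A'\<close>, nilpotency puts \<open>x\<close> into the kernel of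
  \<open>T\<close>, which is \<open>b\<close>-orthogonal to the range of \<open>A'\<close>. So
  \<open>x\<close> is orthogonal to \<open>y = - x\<close> and both vanish.\<close>

lemma ker_weighted_sum:
  "u \<in> ker (op_sum T A') \<longleftrightarrow> T u = Some 0 \<and> A' u = Some 0"
proof
  assume "u \<in> ker (op_sum T A')"
  then obtain x y where xy: "T u = Some x" "A' u = Some y" "x + y = 0"
    unfolding ker_def by (auto simp: op_sum_eq_Some_iff)
  have "b x y = 0"
    using A'_iff[of u y] xy nilpotent by (metis b.zero_left)
  moreover have "y = - x"
    using xy(3) by (metis add_eq_0_iff)
  ultimately have "x = 0"
    by (simp add: b.minus_right b.form_eq_0_iff)
  then show "T u = Some 0 \<and> A' u = Some 0"
    using xy by simp
qed (auto simp: ker_def op_sum_eq_Some_iff)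

text \<open>
  A vector orthogonal to the range of the adjoint lies in the kernel: apply the bipolar
  property to the graph in the product space.
\<close>

lemma mem_ker_if_orthogonal_ran_A:
  assumes "\<And>z w. A z = Some w \<Longrightarrow> a x w = 0"
  shows "T x = Some 0"
proof -
  interpret ab: coercive_form "\<lambda>x y. a (fst x) (fst y) + a (snd x) (snd y)"
    using a.coercive_form_axioms by (rule coercive_form_prod)
  have "(x, 0) \<in> Map.graph T"
  proof (rule ab.mem_if_orthogonal_complement[OF subspace_graph closed_graph])
    fix y assume y: "\<And>s. s \<in> Map.graph T \<Longrightarrow> a (fst s) (fst y) + a (snd s) (snd y) = 0"
    \<comment> \<open>A pair orthogonal to the graph of \<open>T\<close> is a rotated pair of the
      graph of \<open>A\<close>.\<close>
    have "A (snd y) = Some (- fst y)"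
      unfolding A_iff
    proof (intro allI impI)
      fix u v assume "T u = Some v"
      then have "a u (fst y) + a v (snd y) = 0"
        using y[of "(u, v)"] by (simp add: Map.graph_def)
      then show "a v (snd y) = a u (- fst y)"
        by (simp add: a.minus_right)
    qed
    then show "a (fst (x, 0)) (fst y) + a (snd (x, 0)) (snd y) = 0"
      using assms by (force simp: a.minus_right a.zero_left)
  qed
  then show ?thesis
    by (simp add: Map.graph_def)
qed

section \<open>The range of the sum contains both ranges\<close>

lemma subspace_ran_A: "subspace (ran A)"
proof (rule subspaceI)
  show "0 \<in> ran A"
    unfolding ran_def using A_iff[of 0 0] by (force simp: a.zero_right)
  show "x + y \<in> ran A" if xy: "x \<in> ran A" "y \<in> ran A" for x y
  proof -
    obtain u v where "A u = Some x" "A v = Some y"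
      using xy by (auto simp: ran_def)
    then have "A (u + v) = Some (x + y)"
      by (simp add: A_iff a.add_right)
    then show ?thesis
      by (auto simp: ran_def)
  qed
  show "c *\<^sub>R x \<in> ran A" if x: "x \<in> ran A" for c x
  proof -
    obtain u where "A u = Some x"
      using x by (auto simp: ran_def)
    then have "A (c *\<^sub>R u) = Some (c *\<^sub>R x)"
      by (simp add: A_iff a.scaleR_right)
    then show ?thesis
      by (auto simp: ran_def)
  qed
qed

text \<open>Removing the kernel component from a preimage keeps its image under \<open>T\<close> and
  makes it orthogonal to the kernel, hence to the range of \<open>T\<close>, so that
  \<open>A\<close> annihilates it.\<close>

lemma ran_subset_ran_sum: "ran T \<subseteq> ran (op_sum T A)"
proof
  fix x assume "x \<in> ran T"
  then obtain u where u: "T u = Some x"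
    by (auto simp: ran_def)
  obtain n where n: "n \<in> ker T" "\<And>s. s \<in> ker T \<Longrightarrow> a s (u - n) = 0"
    using a.orthogonal_projection_exists[OF subspace_ker closed_ker] by blast
  have "T (u - n) = Some x"
    using T_diff[OF u, of n 0] n(1) by (simp add: ker_def)
  moreover have "A (u - n) = Some 0"
    using n(2) closure_ran_subset_ker by (auto simp: A_eq_0_iff)
  ultimately have "op_sum T A (u - n) = Some x"
    by (simp add: op_sum_eq_Some_iff)
  then show "x \<in> ran (op_sum T A)"
    by (rule ranI)
qed

text \<open>Dually, keep only the component \<open>r\<close> of the preimage in the closed range of
  \<open>T\<close>: \<open>A\<close> annihilates the rest, and \<open>T\<close> annihilates
  \<open>r\<close> by nilpotency.\<close>

lemma ran_A_subset_ran_sum: "ran A \<subseteq> ran (op_sum T A)"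
proof
  fix y assume "y \<in> ran A"
  then obtain v where v: "A v = Some y"
    by (auto simp: ran_def)
  obtain r where r: "r \<in> closure (ran T)" "\<And>s. s \<in> closure (ran T) \<Longrightarrow> a s (v - r) = 0"
    using a.orthogonal_projection_exists[OF subspace_closure_real[OF subspace_ran]] by blast
  have "A (v - r) = Some 0"
    using r(2) by (simp add: A_eq_0_iff)
  then have "A r = Some y"
    using v by (simp add: A_iff a.diff_right a.zero_right)
  moreover have "T r = Some 0"
    using r(1) closure_ran_subset_ker by (auto simp: ker_def)
  ultimately have "op_sum T A r = Some y"
    by (simp add: op_sum_eq_Some_iff)
  then show "y \<in> ran (op_sum T A)"
    by (rule ranI)
qed

text \<open>With \<open>n\<close> the \<open>a\<close>-projection of \<open>x\<close> onto the
  kernel and \<open>r\<close> the \<open>b\<close>-projection of \<open>n\<close> onto the closed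
  range, the summands are \<open>n - r\<close> and \<open>r + (x - n)\<close>. The assumption allows
  \<open>r\<close> and \<open>x - n\<close> to be added inside the closure.\<close>

lemma decomposition_exists:
  assumes "subspace (ran (op_sum T A))"
  shows "\<exists>u\<in>ker (op_sum T A'). \<exists>v\<in>closure (ran (op_sum T A)). x = u + v"
proof -
  obtain n where n: "n \<in> ker T" "\<And>s. s \<in> ker T \<Longrightarrow> a s (x - n) = 0"
    using a.orthogonal_projection_exists[OF subspace_ker closed_ker] by blast
  obtain r where r: "r \<in> closure (ran T)" "\<And>s. s \<in> closure (ran T) \<Longrightarrow> b s (n - r) = 0"
    using b.orthogonal_projection_exists[OF subspace_closure_real[OF subspace_ran]] by blast
  have "T (n - r) = Some 0"
    using T_diff[of n 0 r 0] n(1) r(1) closure_ran_subset_ker by (auto simp: ker_def)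
  moreover have "A' (n - r) = Some 0"
    using r(2) closure_subset[of "ran T"] by (auto simp: A'_eq_0_iff ran_def)
  ultimately have "n - r \<in> ker (op_sum T A')"
    by (simp add: ker_weighted_sum)
  \<comment> \<open>By the bipolar property it suffices to test against vectors orthogonal to the
    range of \<open>A\<close>; these lie in the kernel of \<open>T\<close>, to which
    \<open>x - n\<close> is orthogonal.\<close>
  moreover have "x - n \<in> closure (ran A)"
  proof (rule a.mem_if_orthogonal_complement)
    show "subspace (closure (ran A))"
      using subspace_ran_A by (rule subspace_closure_real)
    fix y assume y: "\<And>s. s \<in> closure (ran A) \<Longrightarrow> a s y = 0"
    have "T y = Some 0"
    proof (rule mem_ker_if_orthogonal_ran_A)
      fix z w assume "A z = Some w"
      then have "w \<in> closure (ran A)"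
        using closure_subset[of "ran A"] by (auto simp: ran_def)
      then show "a y w = 0"
        using y a.sym by metis
    qed
    then show "a (x - n) y = 0"
      using n(2) a.sym by (metis (mono_tags) ker_def mem_Collect_eq)
  qed auto
  then have "r + (x - n) \<in> closure (ran (op_sum T A))"
    using r(1) ran_subset_ran_sum ran_A_subset_ran_sum assms
    by (meson closure_mono subsetD subspace_add subspace_closure_real)
  moreover have "x = (n - r) + (r + (x - n))"
    by simp
  ultimately show ?thesis
    by blast
qed

text \<open>Pythagoras twice: for \<open>v = x + y\<close> with \<open>x\<close> in the range of
  \<open>T\<close> and \<open>y\<close> in that of \<open>A\<close>, the vector \<open>u + x\<close>
  is in the kernel and so \<open>a\<close>-orthogonal to \<open>y\<close>, while \<open>u\<close> is
  \<open>b\<close>-orthogonal to \<open>x\<close>. Hence \<open>u + v\<close> controls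
  \<open>u + x\<close>, which controls \<open>u\<close>.\<close>

lemma decomposition_bound:
  "\<exists>K. \<forall>u\<in>ker (op_sum T A'). \<forall>v\<in>closure (ran (op_sum T A)). norm u \<le> K * norm (u + v)"
proof -
  obtain c where c: "c > 0" "\<And>u. c * (norm u)\<^sup>2 \<le> a u u"
    using a.coercive by blast
  obtain c' where c': "c' > 0" "\<And>u. c' * (norm u)\<^sup>2 \<le> b u u"
    using b.coercive by blast
  obtain K where K: "K > 0" "\<And>u v. norm (a u v) \<le> norm u * norm v * K"
    using a.pos_bounded by blast
  obtain K' where K': "K' > 0" "\<And>u v. norm (b u v) \<le> norm u * norm v * K'"
    using b.pos_bounded by blast
  \<comment> \<open>The product of the ratios of upper bound to coercivity constant for the two
    forms; it bounds squared norms, hence the later \<open>sqrt M\<close>.\<close>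
  define M where "M = K * K' / (c * c')"
  have M: "M > 0"
    using c(1) c'(1) K(1) K'(1) by (simp add: M_def)
  have bound: "norm u \<le> sqrt M * norm (u + v)"
    if u: "u \<in> ker (op_sum T A')" and v: "v \<in> ran (op_sum T A)" for u v
  proof -
    obtain z x y where z: "T z = Some x" "A z = Some y" "v = x + y"
      using v by (auto simp: ran_def op_sum_eq_Some_iff)
    have u': "T u = Some 0" "b x u = 0"
      using u z(1) by (auto simp: ker_weighted_sum A'_eq_0_iff)
    have "T (u + x) = Some 0"
      using T_add[OF u'(1) nilpotent[OF z(1)]] by simp
    then have "a (u + x) y = 0"
      using A_orthogonal_ker z(2) by blast
    then have "a (u + x) (u + x) \<le> a (u + v) (u + v)"
      using a.form_add[of "u + x" y] a.form_nonneg[of y] by (simp add: z(3) add.assoc)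
    then have 1: "c * (norm (u + x))\<^sup>2 \<le> K * (norm (u + v))\<^sup>2"
      using c(2)[of "u + x"] K(2)[of "u + v" "u + v"] by (simp add: power2_eq_square mult_ac)
    have "b u u \<le> b (u + x) (u + x)"
      using b.form_add[of u x] b.form_nonneg[of x] u'(2) b.sym[of u x] by simp
    then have 2: "c' * (norm u)\<^sup>2 \<le> K' * (norm (u + x))\<^sup>2"
      using c'(2)[of u] K'(2)[of "u + x" "u + x"] by (simp add: power2_eq_square mult_ac)
    have "c * (c' * (norm u)\<^sup>2) \<le> K' * (c * (norm (u + x))\<^sup>2)"
      using mult_left_mono[OF 2, of c] c(1) by (simp add: mult_ac)
    also have "\<dots> \<le> K' * (K * (norm (u + v))\<^sup>2)"
      using mult_left_mono[OF 1, of K'] K'(1) by simp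
    finally have "(norm u)\<^sup>2 \<le> M * (norm (u + v))\<^sup>2"
      using c(1) c'(1) by (simp add: M_def field_simps)
    then have "norm u \<le> sqrt (M * (norm (u + v))\<^sup>2)"
      by (rule real_le_rsqrt)
    then show ?thesis
      by (simp add: real_sqrt_mult)
  qed
  have "norm u \<le> sqrt M * norm (u + v)"
    if u: "u \<in> ker (op_sum T A')" and v: "v \<in> closure (ran (op_sum T A))" for u v
  proof -
    \<comment> \<open>For fixed \<open>u\<close> the estimate is a closed condition on
      \<open>v\<close>, so it passes to the closure of the range.\<close>
    have "closed {v. norm u \<le> sqrt M * norm (u + v)}"
      by (intro closed_Collect_le continuous_intros)
    then have "closure (ran (op_sum T A)) \<subseteq> {v. norm u \<le> sqrt M * norm (u + v)}"
      using bound[OF u] by (intro closure_minimal) auto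
    then show ?thesis
      using v by blast
  qed
  then show ?thesis
    by blast
qed

end

subsection \<open>Real parts\<close>

text \<open>
  The squared norm of \<open>x + 1\<close> exceeds that of \<open>x\<close> by \<open>x + conjg x + 1\<close>.
\<close>

definition re_part :: "'k::conj_field \<Rightarrow> real"
  where "re_part x = ((norm (x + 1))\<^sup>2 - (norm x)\<^sup>2 - 1) / 2"

lemma conjg_of_real: "conjg (of_real r :: 'k::conj_field) = of_real r"
proof (cases "r = 0")
  case True
  have "conjg (0 :: 'k) + conjg 0 = conjg 0"
    by (metis add_0 conj_add)
  then show ?thesis
    using True by simp
next
  case False
  have "(of_real r :: 'k) * conjg (of_real r) = of_real r * of_real r"
    using mult_conj[of "of_real r :: 'k"] by (simp add: scaleR_conv_of_real power2_eq_square flip: of_real_mult)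
  then show ?thesis
    using False by simp
qed

lemma of_real_re_part: "of_real (2 * re_part x) = x + conjg (x :: 'k::conj_field)"
proof -
  have one: "conjg (1 :: 'k) = 1"
    using conjg_of_real[of 1, where 'k = 'k] by simp
  have m: "x * conjg x = of_real ((norm x)\<^sup>2)" for x :: 'k
    using mult_conj[of x] by (simp add: scaleR_conv_of_real)
  have "x * conjg x + x + conjg x + 1 = (x + 1) * conjg (x + 1)"
    by (simp add: conj_add one algebra_simps)
  then have "x + conjg x = of_real ((norm (x + 1))\<^sup>2) - of_real ((norm x)\<^sup>2) - 1"
    unfolding m by (simp add: algebra_simps)
  then show ?thesis
    by (simp add: re_part_def)
qed

text \<open>Replaces the norm formula by \<open>x + conjg x\<close>, so that linearity follows from
  the laws of conjugation.\<close>

lemma re_part_eqI: "of_real (2 * r) = x + conjg (x :: 'k::conj_field) \<Longrightarrow> re_part x = r"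
  by (metis of_real_re_part of_real_eq_iff mult_cancel_left zero_neq_numeral)

lemma re_part_add: "re_part (x + y) = re_part x + re_part (y :: 'k::conj_field)"
proof (rule re_part_eqI)
  have "of_real (2 * (re_part x + re_part y)) = (of_real (2 * re_part x) + of_real (2 * re_part y) :: 'k)"
    by (simp add: distrib_left)
  then show "of_real (2 * (re_part x + re_part y)) = x + y + conjg (x + y)"
    by (simp only: of_real_re_part conj_add) simp
qed

lemma re_part_of_real_mult: "re_part (of_real r * x) = r * re_part (x :: 'k::conj_field)"
proof (rule re_part_eqI)
  have "of_real (2 * (r * re_part x)) = (of_real r * of_real (2 * re_part x) :: 'k)"
    by simp
  then show "of_real (2 * (r * re_part x)) = of_real r * x + conjg (of_real r * x)"
    by (simp only: of_real_re_part conj_mult conjg_of_real distrib_left)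
qed

lemma re_part_conjg: "re_part (conjg x) = re_part (x :: 'k::conj_field)"
  by (rule re_part_eqI) (simp only: of_real_re_part conj_conj add.commute)

lemma re_part_of_real: "re_part (of_real r :: 'k::conj_field) = r"
  by (rule re_part_eqI) (simp add: conjg_of_real)

text \<open>Taking \<open>c\<close> to be the conjugate of \<open>x - y\<close> turns the difference
  of the two sides into the squared norm of \<open>x - y\<close>.\<close>

lemma eq_if_re_part_eq:
  fixes x y :: "'k::conj_field"
  assumes "\<And>c. re_part (c * x) = re_part (c * y)"
  shows "x = y"
proof -
  let ?d = "x - y"
  have "re_part (conjg ?d * ?d + conjg ?d * y) = re_part (conjg ?d * y)"
    using assms[of "conjg ?d"] by (simp flip: distrib_left)
  then have "re_part (conjg ?d * ?d) = 0"
    by (simp add: re_part_add)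
  moreover have "conjg ?d * ?d = of_real ((norm ?d)\<^sup>2)"
    using mult_conj[of ?d] by (simp add: scaleR_conv_of_real mult.commute)
  ultimately show ?thesis
    by (metis re_part_of_real eq_iff_diff_eq_0 norm_eq_zero power_eq_0_iff)
qed

subsection \<open>Hilbert spaces over the scalar field\<close>

text \<open>Assumes pointwise positivity only, because it serves to prove boundedness of the
  original form and coercivity of the weighted one.\<close>

lemma form_Cauchy_Schwarz:
  fixes f :: "'a::real_vector \<Rightarrow> 'a \<Rightarrow> real"
  assumes add: "\<And>u v w. f (u + v) w = f u w + f v w"
    and scale: "\<And>r u v. f (r *\<^sub>R u) v = r * f u v"
    and sym: "\<And>u v. f u v = f v u"
    and pos: "\<And>u. u \<noteq> 0 \<Longrightarrow> f u u > 0"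
  shows "(f u v)\<^sup>2 \<le> f u u * f v v"
proof (cases "v = 0")
  case True
  have "f 0 v = 0" for v
    using scale[of 0 0 v] by simp
  then show ?thesis
    using True sym[of u 0] by simp
next
  case False
  have addr: "f w (u + v) = f w u + f w v" and scaler: "f u (r *\<^sub>R v) = r * f u v" for u v w r
    using add scale sym by metis+
  \<comment> \<open>The component of \<open>u\<close> orthogonal to \<open>v\<close>, multiplied by
    \<open>f v v\<close> to avoid division.\<close>
  let ?w = "f v v *\<^sub>R u + (- f u v) *\<^sub>R v"
  have "f ?w ?w = f v v * (f v v * f u u - (f u v)\<^sup>2)"
    by (simp only: add addr scale scaler) (simp add: sym[of v u] algebra_simps power2_eq_square)
  moreover have "f ?w ?w \<ge> 0"
    using pos[of ?w] scale[of 0 0] by (cases "?w = 0") auto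
  ultimately show ?thesis
    using pos[OF False] by (simp add: zero_le_mult_iff mult.commute)
qed

context hilbert_space
begin

lemma ip_add_right: "ip u (v + w) = ip u v + ip u w"
  by (metis ip_conj ip_add_left conj_add)

lemma ip_scale_right: "ip u (smul c v) = conjg c * ip u v"
  by (metis ip_conj ip_scale_left conj_mult)

lemma re_ip_sym: "re_part (ip u v) = re_part (ip v u)"
  by (metis ip_conj re_part_conjg)

lemma re_ip_add_left: "re_part (ip (u + v) w) = re_part (ip u w) + re_part (ip v w)"
  by (simp add: ip_add_left re_part_add)

lemma re_ip_add_right: "re_part (ip w (u + v)) = re_part (ip w u) + re_part (ip w v)"
  by (simp add: ip_add_right re_part_add)

lemma re_ip_scaleR_left: "re_part (ip (r *\<^sub>R u) v) = r * re_part (ip u v)"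
  by (metis scale_of_real ip_scale_left re_part_of_real_mult)

lemma re_ip_scaleR_right: "re_part (ip u (r *\<^sub>R v)) = r * re_part (ip u v)"
  by (metis re_ip_sym re_ip_scaleR_left)

lemma re_ip_self: "re_part (ip u u) = (norm u)\<^sup>2"
  by (metis ip_self re_part_of_real)

lemma abs_re_ip_le: "\<bar>re_part (ip u v)\<bar> \<le> norm u * norm v"
proof -
  have "(re_part (ip u v))\<^sup>2 \<le> re_part (ip u u) * re_part (ip v v)"
    by (rule form_Cauchy_Schwarz[where f = "\<lambda>u v. re_part (ip u v)",
        OF re_ip_add_left re_ip_scaleR_left re_ip_sym]) (simp add: re_ip_self)
  then show ?thesis
    by (simp add: re_ip_self abs_le_square_iff[symmetric] abs_mult flip: power_mult_distrib)
qed

lemma coercive_form_ip: "coercive_form (\<lambda>u v. re_part (ip u v))"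
proof
  show "\<exists>K. \<forall>u v. norm (re_part (ip u v)) \<le> norm u * norm v * K"
    using abs_re_ip_le by (intro exI[of _ 1]) simp
  show "\<exists>c>0. \<forall>u. c * (norm u)\<^sup>2 \<le> re_part (ip u u)"
    by (intro exI[of _ 1]) (simp add: re_ip_self)
qed (simp_all add: re_ip_add_left re_ip_add_right re_ip_scaleR_left re_ip_scaleR_right re_ip_sym[symmetric])

text \<open>Positive definiteness is pointwise; the uniform lower bound comes from the bounded
  inverse, since \<open>norm u\<close> is at most \<open>L * norm (B u)\<close> and the square of
  \<open>norm (B u)\<close> is at most \<open>K * f u u\<close>.\<close>

lemma coercive_form_weighted_ip:
  assumes bdd: "bounded_operator smul B" and pos: "positive_definite ip B"
    and sa: "self_adjoint ip B" and iso: "isomorphism smul B"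
  shows "coercive_form (\<lambda>u v. re_part (weighted_ip B ip u v))"
proof -
  interpret B: Vector_Spaces.linear smul smul B
    using bdd by (simp add: bounded_operator_def)
  define f where "f u v = re_part (ip (B u) v)" for u v
  obtain K0 where K0: "\<And>u. norm (B u) \<le> K0 * norm u"
    using bdd by (auto simp: bounded_operator_def)
  \<comment> \<open>The maximum with 1 makes the constant positive; likewise for
    \<open>L\<close>.\<close>
  define K where "K = max K0 1"
  have K: "K > 0" "norm (B u) \<le> K * norm u" for u
    using K0[of u] mult_right_mono[of K0 K "norm u"] by (auto simp: K_def)
  obtain L0 where L0: "\<And>u. norm (inv B u) \<le> L0 * norm u"
    using iso by (auto simp: isomorphism_def bounded_operator_def)
  define L where "L = max L0 1"
  have L: "L > 0" "norm u \<le> L * norm (B u)" for u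
  proof -
    have "norm (inv B (B u)) \<le> L * norm (B u)"
      using L0[of "B u"] mult_right_mono[of L0 L "norm (B u)"] by (auto simp: L_def)
    then show "norm u \<le> L * norm (B u)"
      using iso by (simp add: isomorphism_def bij_is_inj)
  qed (simp add: L_def)
  have B_scaleR: "B (r *\<^sub>R u) = r *\<^sub>R B u" for r u
    by (metis scale_of_real B.scale)
  have sym: "f u v = f v u" for u v
    unfolding f_def using sa by (metis self_adjoint_def re_ip_sym)
  have add: "f (u + v) w = f u w + f v w" for u v w
    by (simp add: f_def B.add re_ip_add_left)
  have scaleR: "f (r *\<^sub>R u) v = r * f u v" for r u v
    by (simp add: f_def B_scaleR re_ip_scaleR_left)
  have fpos: "f u u > 0" if "u \<noteq> 0" for u
    using pos that unfolding positive_definite_def f_def by (metis re_part_of_real)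
  have le: "\<bar>f u v\<bar> \<le> norm u * norm v * K" for u v
  proof -
    have "\<bar>f u v\<bar> \<le> norm (B u) * norm v"
      unfolding f_def by (rule abs_re_ip_le)
    also have "\<dots> \<le> K * norm u * norm v"
      using K(2) by (intro mult_right_mono) auto
    finally show ?thesis
      by (simp add: mult_ac)
  qed
  \<comment> \<open>Cauchy--Schwarz for the weighted form, applied to \<open>u\<close> and \<open>B u\<close>.\<close>
  have lower: "(norm u)\<^sup>2 \<le> L\<^sup>2 * K * f u u" for u
  proof (cases "u = 0")
    case False
    then have Bu: "norm (B u) > 0"
      using L(2)[of u] L(1) by (cases "B u = 0") auto
    have fB: "f u (B u) = (norm (B u))\<^sup>2"
      by (simp add: f_def re_ip_self)
    have "(f u (B u))\<^sup>2 \<le> f u u * f (B u) (B u)"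
      using add scaleR sym fpos by (rule form_Cauchy_Schwarz)
    also have "\<dots> \<le> f u u * ((norm (B u))\<^sup>2 * K)"
      using le[of "B u" "B u"] fpos[OF False] by (intro mult_left_mono) (auto simp: power2_eq_square)
    finally have "(norm (B u))\<^sup>2 * (norm (B u))\<^sup>2 \<le> (norm (B u))\<^sup>2 * (f u u * K)"
      by (simp add: fB power2_eq_square mult_ac)
    then have 1: "(norm (B u))\<^sup>2 \<le> f u u * K"
      using Bu by (simp only: mult_le_cancel_left_pos zero_less_power)
    have "(norm u)\<^sup>2 \<le> (L * norm (B u))\<^sup>2"
      using L(2) by (intro power_mono) auto
    also have "\<dots> \<le> L\<^sup>2 * (f u u * K)"
      using 1 by (simp add: power_mult_distrib mult_left_mono)
    finally show ?thesis
      by (simp add: mult_ac)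
  qed (simp add: scaleR[of 0 0, simplified])
  have "coercive_form f"
  proof
    show "\<exists>K. \<forall>u v. norm (f u v) \<le> norm u * norm v * K"
      using le by auto
    show "\<exists>c>0. \<forall>u. c * (norm u)\<^sup>2 \<le> f u u"
      using lower K(1) L(1) by (intro exI[of _ "1 / (L\<^sup>2 * K)"]) (simp add: field_simps)
    show "f u (v + w) = f u v + f u w" for u v w
      by (metis sym add)
    show "f u (r *\<^sub>R v) = r *\<^sub>R f u v" for u v r
      using scaleR[of r v u] sym by simp
  qed (auto simp: add scaleR intro: sym)
  then show ?thesis
    by (simp add: f_def[abs_def] weighted_ip_def)
qed

text \<open>Derived from \<open>ip_self\<close> and \<open>mult_conj\<close>; it makes scalar
  multiplication continuous, as closures of subspaces over \<open>'k\<close> require.\<close>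

lemma norm_smul: "norm (smul c u) = norm c * norm u"
proof -
  have "of_real ((norm (smul c u))\<^sup>2) = c * conjg c * ip u u"
    unfolding ip_self[symmetric] by (simp add: ip_scale_left ip_scale_right)
  also have "\<dots> = of_real ((norm c * norm u)\<^sup>2)"
    by (simp add: mult_conj scaleR_conv_of_real ip_self power_mult_distrib)
  finally have "(norm (smul c u))\<^sup>2 = (norm c * norm u)\<^sup>2"
    by (simp only: of_real_eq_iff)
  then show ?thesis
    by simp
qed

lemma continuous_on_smul: "continuous_on UNIV (smul c)"
proof -
  have "bounded_linear (smul c)"
  proof (rule bounded_linear_intro[where K = "norm c"])
    show "smul c (r *\<^sub>R u) = r *\<^sub>R smul c u" for r u
      by (metis scale_of_real scale_left_commute)
  qed (simp_all add: scale_right_distrib norm_smul mult.commute)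
  then show ?thesis
    by (rule linear_continuous_on)
qed

section \<open>Linear operators and adjoints over the scalar field\<close>

lemma real_subspace: "subspace S \<Longrightarrow> real_vector.subspace S"
  by (metis real_vector.subspaceI subspace_0 subspace_add subspace_scale scale_of_real)

text \<open>A relational form of linearity that speaks of the graph directly. The value at 0 comes
  from scaling by 0.\<close>

lemma linear_operator_iff:
  "linear_operator smul T \<longleftrightarrow> T 0 = Some 0 \<and>
    (\<forall>u v x y. T u = Some x \<longrightarrow> T v = Some y \<longrightarrow> T (u + v) = Some (x + y)) \<and>
    (\<forall>c u x. T u = Some x \<longrightarrow> T (smul c u) = Some (smul c x))"
    (is "?L \<longleftrightarrow> ?R")
proof
  assume L: ?L
  then have S: "subspace (dom T)"
    and add: "\<And>u v. u \<in> dom T \<Longrightarrow> v \<in> dom T \<Longrightarrow> the (T (u + v)) = the (T u) + the (T v)"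
    and scale: "\<And>c u. u \<in> dom T \<Longrightarrow> the (T (smul c u)) = smul c (the (T u))"
    by (auto simp: linear_operator_def)
  have "T (u + v) = Some (x + y)" if "T u = Some x" "T v = Some y" for u v x y
    using that add[of u v] subspace_add[OF S, of u v] by force
  moreover have sc: "T (smul c u) = Some (smul c x)" if "T u = Some x" for c u x
    using that scale[of u c] subspace_scale[OF S, of u c] by force
  moreover have "T 0 = Some 0"
    using sc[of 0 _ 0] subspace_0[OF S] by force
  ultimately show ?R
    by blast
next
  assume ?R
  then show ?L
    unfolding linear_operator_def by (auto simp: dom_def intro!: subspaceI)
qed

lemma real_subspace_graph:
  assumes "linear_operator smul T"
  shows "real_vector.subspace (Map.graph T)"
  using assms unfolding linear_operator_iff Map.graph_def
  by (intro real_vector.subspaceI) (auto simp: zero_prod_def simp flip: scale_of_real)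

lemma linear_operator_op_sum:
  assumes "linear_operator smul S" "linear_operator smul T"
  shows "linear_operator smul (op_sum S T)"
  using assms unfolding linear_operator_iff op_sum_eq_Some_iff
  by (fastforce simp: scale_right_distrib)

lemma subspace_ker:
  "linear_operator smul T \<Longrightarrow> subspace (ker T)"
  unfolding linear_operator_iff ker_def by (force intro!: subspaceI)

lemma subspace_ran:
  "linear_operator smul T \<Longrightarrow> subspace (ran T)"
  unfolding linear_operator_iff ran_def by (fastforce intro!: subspaceI)

text \<open>The domain is closed under scalars, so the real-part identity holds for all multiples
  \<open>c * p x v\<close> and yields the full one. Density makes the vector unique, so the definite
  description denotes it.\<close>

lemma op_adjoint_eq_Some_iff:
  assumes T: "linear_operator smul T" "densely_defined T"
    and p: "\<And>c u v. p (smul c u) v = c * p u v" "coercive_form (\<lambda>u v. re_part (p u v))"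
  shows "op_adjoint p T v = Some w \<longleftrightarrow> (\<forall>u x. T u = Some x \<longrightarrow> re_part (p x v) = re_part (p u w))"
proof -
  interpret p: coercive_form "\<lambda>u v. re_part (p u v)" by (fact p(2))
  define Q where "Q w \<longleftrightarrow> (\<forall>u\<in>dom T. p (the (T u)) v = p u w)" for w
  have Q_iff: "Q w \<longleftrightarrow> (\<forall>u x. T u = Some x \<longrightarrow> re_part (p x v) = re_part (p u w))" for w
  proof
    assume R: "\<forall>u x. T u = Some x \<longrightarrow> re_part (p x v) = re_part (p u w)"
    have "p x v = p u w" if "T u = Some x" for u x
    proof (rule eq_if_re_part_eq)
      fix c
      have "T (smul c u) = Some (smul c x)"
        using T(1) that by (simp add: linear_operator_iff)
      then show "re_part (c * p x v) = re_part (c * p u w)"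
        using R by (metis p(1))
    qed
    then show "Q w"
      by (auto simp: Q_def)
  qed (force simp: Q_def)
  have uniq: "w = w'" if "Q w" "Q w'" for w w'
    using T(2) that unfolding densely_defined_def Q_def
    by (intro p.eq_if_form_eq_on_dense[of "dom T"]) auto
  have "op_adjoint p T v = (if \<exists>w. Q w then Some (THE w. Q w) else None)"
    by (simp add: op_adjoint_def Q_def)
  also have "\<dots> = Some w \<longleftrightarrow> Q w"
    using uniq by (auto intro: theI the_equality)
  finally show ?thesis
    unfolding Q_iff .
qed

lemma linear_operator_op_adjoint:
  assumes T: "linear_operator smul T" "densely_defined T"
    and p: "\<And>c u v. p (smul c u) v = c * p u v" "\<And>c u v. p u (smul c v) = conjg c * p u v"
      "coercive_form (\<lambda>u v. re_part (p u v))"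
  shows "linear_operator smul (op_adjoint p T)"
proof -
  interpret p: coercive_form "\<lambda>u v. re_part (p u v)" by (fact p(3))
  note iff = op_adjoint_eq_Some_iff[OF T p(1) p(3)]
  have "op_adjoint p T (smul c v) = Some (smul c w)" if "op_adjoint p T v = Some w" for c v w
    unfolding iff
  proof (intro allI impI)
    fix u x assume "T u = Some x"
    \<comment> \<open>A scalar in the second argument moves to the first as its conjugate, so the
      adjoint identity is used at \<open>smul (conjg c) u\<close>.\<close>
    then have "T (smul (conjg c) u) = Some (smul (conjg c) x)"
      using T(1) by (simp add: linear_operator_iff)
    then show "re_part (p x (smul c v)) = re_part (p u (smul c w))"
      using that unfolding iff by (metis p(1,2))
  qed
  then show ?thesis
    unfolding linear_operator_iff by (auto simp: iff p.zero_right p.add_right)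
qed

text \<open>The bound at \<open>v = - u\<close> makes the intersection trivial, and in general it
  makes the projection \<open>g\<close> onto \<open>U\<close> Lipschitz; addition is then inverted
  by the pair of \<open>g x\<close> and \<open>x - g x\<close>.\<close>

lemma topological_direct_sumI:
  assumes U: "subspace U" and V: "subspace V"
    and ex: "\<And>x. \<exists>u\<in>U. \<exists>v\<in>V. x = u + v"
    and bound: "\<And>u v. u \<in> U \<Longrightarrow> v \<in> V \<Longrightarrow> norm u \<le> K * norm (u + v)"
  shows "topological_direct_sum smul UNIV U V"
proof -
  have int: "U \<inter> V = {0}"
  proof -
    have "u = 0" if "u \<in> U" "u \<in> V" for u
      using bound[OF that(1) subspace_neg[OF V that(2)]] by simp
    then show ?thesis
      using subspace_0[OF U] subspace_0[OF V] by auto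
  qed
  obtain g h where gh: "\<And>x. g x \<in> U" "\<And>x. h x \<in> V" "\<And>x. x = g x + h x"
    using ex by metis
  have uniq: "g (u + v) = u" if "u \<in> U" "v \<in> V" for u v
  proof -
    have "g (u + v) - u = v - h (u + v)"
      using gh(3)[of "u + v"] by (simp add: algebra_simps)
    then have "g (u + v) - u \<in> U \<inter> V"
      using subspace_diff[OF U gh(1) that(1)] subspace_diff[OF V that(2) gh(2)] by (metis IntI)
    then show ?thesis
      by (simp add: int)
  qed
  \<comment> \<open>\<open>g\<close> was chosen pointwise; its compatibility with differences comes
    from uniqueness of the decomposition.\<close>
  have g_diff: "g x - g y = g (x - y)" for x y
  proof -
    have "x - y = (g x - g y) + (h x - h y)"
      using gh(3)[of x] gh(3)[of y] by (simp add: algebra_simps)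
    then show ?thesis
      using uniq[OF subspace_diff[OF U gh(1) gh(1)] subspace_diff[OF V gh(2) gh(2)]] by metis
  qed
  have "dist (g x) (g y) \<le> max K 0 * dist x y" for x y
  proof -
    have "norm (g (x - y)) \<le> K * norm (x - y)"
      using bound[OF gh(1,2)] gh(3) by metis
    also have "\<dots> \<le> max K 0 * norm (x - y)"
      by (intro mult_right_mono) auto
    finally show ?thesis
      by (simp add: dist_norm g_diff)
  qed
  then have "(max K 0)-lipschitz_on UNIV g"
    by (intro lipschitz_onI) auto
  then have cont: "continuous_on UNIV g"
    by (rule lipschitz_on_continuous_on)
  have h: "h x = x - g x" for x
    using gh(3)[of x] by (simp add: algebra_simps)
  have "homeomorphism (U \<times> V) UNIV (\<lambda>(u, v). u + v) (\<lambda>x. (g x, x - g x))"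
  proof (rule homeomorphismI)
    show "continuous_on (U \<times> V) (\<lambda>(u, v). u + v)"
      by (auto simp: case_prod_unfold intro!: continuous_intros)
    show "continuous_on UNIV (\<lambda>x. (g x, x - g x))"
      by (intro continuous_intros cont)
    show "(\<lambda>x. (g x, x - g x)) ` UNIV \<subseteq> U \<times> V"
      using gh(1,2) h by auto
  qed (auto simp: uniq)
  then show ?thesis
    unfolding topological_direct_sum_def using U V int ex
    by (auto simp: set_plus_def)
qed

end

section \<open>Transfer of the real decomposition to the Hilbert space\<close>

theorem propositionA14:
  fixes smul :: "'k::conj_field \<Rightarrow> 'h::banach \<Rightarrow> 'h"
    and ip :: "'h \<Rightarrow> 'h \<Rightarrow> 'k"
    and \<Gamma> P P\<^sub>B :: "'h \<rightharpoonup> 'h"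
    and B :: "'h \<Rightarrow> 'h"
    and X :: "'h set"
  assumes "hilbert_space smul ip"
    and "separable_space (euclidean :: 'h topology)"
    and "linear_operator smul \<Gamma>"
    and "closed_operator \<Gamma>"
    and "densely_defined \<Gamma>"
    and "nilpotent \<Gamma>"
    and "bounded_operator smul B"
    and "positive_definite ip B"
    and "self_adjoint ip B"
    and "isomorphism smul B"
  defines "P \<equiv> op_sum \<Gamma> (op_adjoint ip \<Gamma>)"
    and "P\<^sub>B \<equiv> op_sum \<Gamma> (op_adjoint (weighted_ip B ip) \<Gamma>)"
  defines "X \<equiv> ker P\<^sub>B + closure (ran P)"
  shows "topological_direct_sum smul X (ker P\<^sub>B) (closure (ran P)) \<and> X = UNIV"
proof -
  interpret hilbert_space smul ip by fact
  interpret B: Vector_Spaces.linear smul smul B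
    using assms(7) by (simp add: bounded_operator_def)
  have form: "coercive_form (\<lambda>u v. re_part (ip u v))"
    by (rule coercive_form_ip)
  have formB: "coercive_form (\<lambda>u v. re_part (weighted_ip B ip u v))"
    using assms(7-10) by (rule coercive_form_weighted_ip)
  have wl: "weighted_ip B ip (smul c u) v = c * weighted_ip B ip u v"
    and wr: "weighted_ip B ip u (smul c v) = conjg c * weighted_ip B ip u v" for c u v
    by (simp_all add: weighted_ip_def B.scale ip_scale_left ip_scale_right)
  interpret nilpotent_pair "\<lambda>u v. re_part (ip u v)" "\<lambda>u v. re_part (weighted_ip B ip u v)"
    \<Gamma> "op_adjoint ip \<Gamma>" "op_adjoint (weighted_ip B ip) \<Gamma>"
  proof (intro nilpotent_pair.intro nilpotent_pair_axioms.intro form formB)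
    show "\<Gamma> v = Some 0" if "\<Gamma> u = Some v" for u v
      using assms(6) that by (auto simp: nilpotent_def ker_def ran_def)
  qed (use assms(3-5) in \<open>simp_all add: real_subspace_graph closed_operator_def
      op_adjoint_eq_Some_iff form formB wl ip_scale_left\<close>)
  \<comment> \<open>The decomposition and its bound concern real forms; linearity of the two sums
    over \<open>'k\<close> makes the summands subspaces over \<open>'k\<close>.\<close>
  have lin: "linear_operator smul P"
    unfolding P_def using assms(3,5) form
    by (intro linear_operator_op_sum linear_operator_op_adjoint) (auto simp: ip_scale_left ip_scale_right)
  have linB: "linear_operator smul P\<^sub>B"
    unfolding P\<^sub>B_def using assms(3,5) formB
    by (intro linear_operator_op_sum linear_operator_op_adjoint) (auto simp: wl wr)
  have ran: "module.subspace smul (ran P)"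
    using lin by (rule hilbert_space.subspace_ran[OF assms(1)])
  have ex: "\<exists>u\<in>ker P\<^sub>B. \<exists>v\<in>closure (ran P). x = u + v" for x
    using decomposition_exists real_subspace[OF ran] unfolding P_def P\<^sub>B_def by blast
  obtain K where "\<And>u v. u \<in> ker P\<^sub>B \<Longrightarrow> v \<in> closure (ran P) \<Longrightarrow> norm u \<le> K * norm (u + v)"
    using decomposition_bound unfolding P_def P\<^sub>B_def by blast
  then have "topological_direct_sum smul UNIV (ker P\<^sub>B) (closure (ran P))"
    using ex hilbert_space.subspace_ker[OF assms(1) linB]
      subspace_closure[OF module_axioms continuous_on_smul ran]
    by (intro topological_direct_sumI)
  moreover have "X = UNIV"
    using ex unfolding X_def set_plus_def by blast
  ultimately show ?thesis
    by simp
qed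

end
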